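(* Let $(a_{i,j})_{i,j\ge 1}$ be real numbers such that $a_{i,j}=a_{j,i}\ge 0$ for all $i,j\ge 1$, and suppose there is $A_1>0$ with $a_{i,j}\le A_1\, i j$ for all $i,j\ge 1$. Let $b_{i,j;k}\ge 0$ ($1\le i\le j-1$, $j\ge 2$, $k\ge 1$) satisfy $$\sum_{i=1}^{j-1} i\, b_{i,j;k}=j,\qquad j\ge 2,\ k\ge 1,$$ and suppose there are constants $\beta_0,\beta_1\ge 0$ such that $$b_{s,i;j}\le \beta_0+\beta_1 b_{s,j;i},\qquad 1\le s\le i-1,\ j\ge i.$$ For an integer $m\ge1$ put $$Y_1^{\sharp m}:=\{y\in Y_1^+ : y_i=0\ \text{ for all } i>m\}.$$ Suppose there is an integer $m\ge 1$ such that $w^{\rm in}\in Y_1^{\sharp m}$. Then the constructed solution $w$ (in the sense of the context) on $[0,+\infty)$ to the discrete collision-induced breakage equation with initial condition $w^{\rm in}$ satisfies $w(t)\in Y_1^{\sharp m}$ for all $t\ge 0$. Equivalently, for every integer $m\ge 1$, the set $Y_1^{\sharp m}$ is positively invariant for the discrete collision-induced breakage equation.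
   Context: Function spaces. For $\gamma_0\ge 0$, $Y_{\gamma_0}$ is the Banach space of real sequences $y=(y_i)_{i\ge1}$ with $\|y\|_{\gamma_0}:=\sum_{i\ge 1} i^{\gamma_0}|y_i|<\infty$, and $Y_{\gamma_0}^+:=\{y\in Y_{\gamma_0}: y_i\ge 0 \text{ for all } i\ge 1\}$. Equation. The discrete collision-induced breakage equation is $$\frac{dw_i}{dt}=\sum_{j=i+1}^{\infty}\sum_{k=1}^{\infty} a_{j,k}\, b_{i,j;k}\, w_j w_k-\sum_{j=1}^{\infty}a_{i,j}w_iw_j,\qquad w_i(0)=w_i^{\rm in},\qquad i\ge 1.$$ Solution. Let $T\in(0,+\infty]$ and $w^{\rm in}\in Y_1^+$. A solution on $[0,T)$ is a sequence $w=(w_i)_{i\ge 1}$ of non-negative continuous functions such that for each $i\ge 1$ and $t\in(0,T)$: (1) $w_i\in \mathcal C([0,T))$, $\sum_{j=1}^\infty a_{i,j}w_j\in L^1(0,t)$, and $\sum_{j=i+1}^\infty\sum_{k=1}^\infty b_{i,j;k}a_{j,k}w_jw_k\in L^1(0,t)$; (2) $$w_i(t)=w_i^{\rm in}+\int_0^t\Big(\sum_{j=i+1}^{\infty}\sum_{k=1}^{\infty} b_{i,j;k}a_{j,k}w_j(\tau)w_k(\tau)-\sum_{j=1}^{\infty}a_{i,j}w_i(\tau)w_j(\tau)\Big)d\tau .$$ Truncated systems. For $l\ge 3$, $w^l=(w_i^l)_{1\le i\le l}\in \mathcal C^1([0,+\infty);\mathbb R^l)$ is the unique (global, non-negative) solution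 to $$\frac{dw_i^l}{dt}=\sum_{j=i+1}^{l-1}\sum_{k=1}^{l-j} b_{i,j;k}a_{j,k}w_j^lw_k^l-\sum_{j=1}^{l-i}a_{i,j}w_i^lw_j^l,\qquad w_i^l(0)=w_i^{\rm in},\qquad 1\le i\le l,$$ where the right-hand side is zero for $i=l$. Constructed solution. The constructed solution is a solution $w$ on $[0,+\infty)$ obtained as a limit of truncated solutions: there is a strictly increasing sequence of integers $(l_n)$ with $\lim_{n\to\infty}w_i^{l_n}(t)=w_i(t)$ for all $i\ge1$, $t\ge0$, and $w$ satisfies $\|w(t)\|_1=\|w^{\rm in}\|_1$ for $t\ge 0$ and $\sum_{i\ge r} i w_i(t)\le\sum_{i\ge r} i w_i^{\rm in}$ for all $r\ge1$, $t\ge 0$. Positive invariance of $Y_1^{\sharp m}$ means that constructed solutions starting in $Y_1^{\sharp m}$ remain in $Y_1^{\sharp m}$ for all $t\ge0$. *)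

theory Defs
  imports "HOL-Analysis.Analysis"
begin

text \<open>
  Sequences indexed by $i \ge 1$ are functions on \<^typ>\<open>nat\<close> whose value at 0 is never
  referred to. Coefficients: \<open>a j k\<close> is $a_{j,k}$ and \<open>b i j k\<close> is $b_{i,j;k}$.
  A time-dependent sequence \<open>w\<close> has \<open>w t i\<close> $= w_i(t)$.
\<close>

definition Y :: "real \<Rightarrow> (nat \<Rightarrow> real) set" where
  "Y \<gamma> = {y. (\<lambda>i. real i powr \<gamma> * \<bar>y i\<bar>) summable_on {1..}}"

definition Y_norm :: "real \<Rightarrow> (nat \<Rightarrow> real) \<Rightarrow> real" where
  "Y_norm \<gamma> y = (\<Sum>\<^sub>\<infinity>i\<in>{1..}. real i powr \<gamma> * \<bar>y i\<bar>)"

definition Y_plus :: "real \<Rightarrow> (nat \<Rightarrow> real) set" where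
  "Y_plus \<gamma> = {y \<in> Y \<gamma>. \<forall>i\<ge>1. 0 \<le> y i}"

definition Y1_sharp :: "nat \<Rightarrow> (nat \<Rightarrow> real) set" where
  "Y1_sharp m = {y \<in> Y_plus 1. \<forall>i>m. y i = 0}"

definition gain :: "(nat \<Rightarrow> nat \<Rightarrow> real) \<Rightarrow> (nat \<Rightarrow> nat \<Rightarrow> nat \<Rightarrow> real) \<Rightarrow> (nat \<Rightarrow> real) \<Rightarrow> nat \<Rightarrow> real" where
  "gain a b y i = (\<Sum>\<^sub>\<infinity>j\<in>{i+1..}. \<Sum>\<^sub>\<infinity>k\<in>{1..}. b i j k * a j k * y j * y k)"

definition loss :: "(nat \<Rightarrow> nat \<Rightarrow> real) \<Rightarrow> (nat \<Rightarrow> real) \<Rightarrow> nat \<Rightarrow> real" where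
  "loss a y i = (\<Sum>\<^sub>\<infinity>j\<in>{1..}. a i j * y i * y j)"

text \<open>
  Since an \<^const>\<open>infsum\<close> of reals is 0 when the family is not summable, membership of a
  series in $L^1(0,t)$ is stated as convergence for almost every time in $(0,t)$ together with
  integrability of the sum. All terms are non-negative, so convergence of the iterated series
  is summability over the product of the index sets.
\<close>

definition breakage_solution ::
  "ereal \<Rightarrow> (nat \<Rightarrow> nat \<Rightarrow> real) \<Rightarrow> (nat \<Rightarrow> nat \<Rightarrow> nat \<Rightarrow> real) \<Rightarrow> (nat \<Rightarrow> real) \<Rightarrow> (real \<Rightarrow> nat \<Rightarrow> real) \<Rightarrow> bool" where
  "breakage_solution T a b w_in w \<longleftrightarrow>
     0 < T \<and> w_in \<in> Y_plus 1 \<and>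
     (\<forall>i\<ge>1.
        continuous_on {t. 0 \<le> t \<and> ereal t < T} (\<lambda>t. w t i) \<and>
        (\<forall>t. 0 \<le> t \<and> ereal t < T \<longrightarrow> 0 \<le> w t i) \<and>
        (\<forall>t. 0 < t \<and> ereal t < T \<longrightarrow>
           (AE \<tau> in lborel. \<tau> \<in> {0<..<t} \<longrightarrow> (\<lambda>j. a i j * w \<tau> j) summable_on {1..}) \<and>
           set_integrable lborel {0<..<t} (\<lambda>\<tau>. \<Sum>\<^sub>\<infinity>j\<in>{1..}. a i j * w \<tau> j) \<and>
           (AE \<tau> in lborel. \<tau> \<in> {0<..<t} \<longrightarrow>
              (\<lambda>(j, k). b i j k * a j k * w \<tau> j * w \<tau> k) summable_on ({i+1..} \<times> {1..})) \<and>
           set_integrable lborel {0<..<t} (\<lambda>\<tau>. gain a b (w \<tau>) i) \<and>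
           w t i = w_in i + (LINT \<tau>:{0<..<t}|lborel. gain a b (w \<tau>) i - loss a (w \<tau>) i)))"

definition truncated_rhs ::
  "nat \<Rightarrow> (nat \<Rightarrow> nat \<Rightarrow> real) \<Rightarrow> (nat \<Rightarrow> nat \<Rightarrow> nat \<Rightarrow> real) \<Rightarrow> (nat \<Rightarrow> real) \<Rightarrow> nat \<Rightarrow> real" where
  "truncated_rhs l a b y i =
     (\<Sum>j=i+1..l-1. \<Sum>k=1..l-j. b i j k * a j k * y j * y k) - (\<Sum>j=1..l-i. a i j * y i * y j)"

text \<open>
  Only the components $1 \le i \le l$ are constrained. They are continuously differentiable
  because \<^const>\<open>truncated_rhs\<close> is polynomial in these components.
\<close>

definition truncated_solution ::
  "nat \<Rightarrow> (nat \<Rightarrow> nat \<Rightarrow> real) \<Rightarrow> (nat \<Rightarrow> nat \<Rightarrow> nat \<Rightarrow> real) \<Rightarrow> (nat \<Rightarrow> real) \<Rightarrow> (real \<Rightarrow> nat \<Rightarrow> real) \<Rightarrow> bool" where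
  "truncated_solution l a b w_in u \<longleftrightarrow>
     3 \<le> l \<and>
     (\<forall>i\<in>{1..l}.
        u 0 i = w_in i \<and>
        (\<forall>t\<ge>0. 0 \<le> u t i \<and>
          ((\<lambda>s. u s i) has_real_derivative truncated_rhs l a b (u t) i) (at t within {0..})))"

definition constructed_solution ::
  "(nat \<Rightarrow> nat \<Rightarrow> real) \<Rightarrow> (nat \<Rightarrow> nat \<Rightarrow> nat \<Rightarrow> real) \<Rightarrow> (nat \<Rightarrow> real) \<Rightarrow> (real \<Rightarrow> nat \<Rightarrow> real) \<Rightarrow> bool" where
  "constructed_solution a b w_in w \<longleftrightarrow>
     breakage_solution \<infinity> a b w_in w \<and>
     (\<exists>l u. strict_mono (l :: nat \<Rightarrow> nat) \<and>
        (\<forall>n. truncated_solution (l n) a b w_in (u n)) \<and>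
        (\<forall>i\<ge>1. \<forall>t\<ge>0. (\<lambda>n. u n t i) \<longlonglongrightarrow> w t i)) \<and>
     (\<forall>t\<ge>0. w t \<in> Y 1 \<and> Y_norm 1 (w t) = Y_norm 1 w_in) \<and>
     (\<forall>r\<ge>1. \<forall>t\<ge>0. (\<Sum>\<^sub>\<infinity>i\<in>{r..}. real i * w t i) \<le> (\<Sum>\<^sub>\<infinity>i\<in>{r..}. real i * w_in i))"

definition positively_invariant ::
  "(nat \<Rightarrow> nat \<Rightarrow> real) \<Rightarrow> (nat \<Rightarrow> nat \<Rightarrow> nat \<Rightarrow> real) \<Rightarrow> (nat \<Rightarrow> real) set \<Rightarrow> bool" where
  "positively_invariant a b S \<longleftrightarrow>
     (\<forall>w_in\<in>S. \<forall>w. constructed_solution a b w_in w \<longrightarrow> (\<forall>t\<ge>0. w t \<in> S))"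

end

theory Submission imports Defs begin

text \<open>A collision only breaks clusters into smaller ones, so mass cannot move up to larger
  sizes. \<open>constructed_solution\<close> records this as the tail estimate for every r \<ge> 1.
  Taking r = m + 1 gives a sum of non-negative terms that is at most 0, so every term
  vanishes.\<close>

text \<open>
  The mass of clusters of size at least \<open>m + 1\<close> is non-negative, and along a constructed solution
  it never exceeds its initial value, which is 0.
\<close>

lemma Y1_sharp_invariant:
  assumes w_in: "w_in \<in> Y1_sharp m" and w: "constructed_solution a b w_in w" and t: "0 \<le> t"
  shows "w t \<in> Y1_sharp m"
proof -
  have Y1: "w t \<in> Y 1"
    and tail: "(\<Sum>\<^sub>\<infinity>i\<in>{m+1..}. real i * w t i) \<le> (\<Sum>\<^sub>\<infinity>i\<in>{m+1..}. real i * w_in i)"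
    using w t by (auto simp: constructed_solution_def)
  have nonneg: "0 \<le> w t i" if "1 \<le> i" for i
    using w t that by (auto simp: constructed_solution_def breakage_solution_def)
  \<comment> \<open>Summability is essential: \<open>infsum\<close> is 0 by default on a
    non-summable family, so the tail bound alone would say nothing about the terms. It comes from
    the finite norm in \<open>Y 1\<close>.\<close>
  have "(\<lambda>i. real i powr 1 * \<bar>w t i\<bar>) summable_on {m+1..}"
    using Y1 unfolding Y_def by (auto intro: summable_on_subset_banach)
  then have summable: "(\<lambda>i. real i * w t i) summable_on {m+1..}"
    by (rule summable_on_cong[THEN iffD1, rotated]) (simp add: nonneg)
  have "(\<Sum>\<^sub>\<infinity>i\<in>{m+1..}. real i * w_in i) = 0"
    using w_in by (intro infsum_0) (auto simp: Y1_sharp_def)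
  then have "real i * w t i = 0" if "i > m" for i
    using tail summable that by (intro nonneg_infsum_le_0D[where A = "{m+1..}"]) (auto simp: nonneg)
  \<comment> \<open>The weight \<open>real i\<close> is nonzero because i > m \<ge> 0, so it
    cancels.\<close>
  then have "w t i = 0" if "i > m" for i
    using that by fastforce
  then show ?thesis
    using Y1 nonneg by (simp add: Y1_sharp_def Y_plus_def)
qed

theorem proposition5p1:
  fixes a :: "nat \<Rightarrow> nat \<Rightarrow> real" and b :: "nat \<Rightarrow> nat \<Rightarrow> nat \<Rightarrow> real"
    and A\<^sub>1 \<beta>\<^sub>0 \<beta>\<^sub>1 :: real
  assumes a_sym: "\<And>i j. 1 \<le> i \<Longrightarrow> 1 \<le> j \<Longrightarrow> a i j = a j i"
    and a_nonneg: "\<And>i j. 1 \<le> i \<Longrightarrow> 1 \<le> j \<Longrightarrow> 0 \<le> a i j"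
    and A1_pos: "0 < A\<^sub>1"
    and a_bound: "\<And>i j. 1 \<le> i \<Longrightarrow> 1 \<le> j \<Longrightarrow> a i j \<le> A\<^sub>1 * real i * real j"
    and b_nonneg: "\<And>i j k. 1 \<le> i \<Longrightarrow> i < j \<Longrightarrow> 1 \<le> k \<Longrightarrow> 0 \<le> b i j k"
    and b_mass: "\<And>j k. 2 \<le> j \<Longrightarrow> 1 \<le> k \<Longrightarrow> (\<Sum>i=1..j-1. real i * b i j k) = real j"
    and beta_nonneg: "0 \<le> \<beta>\<^sub>0" "0 \<le> \<beta>\<^sub>1"
    and b_bound: "\<And>s i j. 1 \<le> s \<Longrightarrow> s < i \<Longrightarrow> i \<le> j \<Longrightarrow> b s i j \<le> \<beta>\<^sub>0 + \<beta>\<^sub>1 * b s j i"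
  shows "(\<forall>m\<ge>1. \<forall>w_in w. w_in \<in> Y1_sharp m \<longrightarrow> constructed_solution a b w_in w \<longrightarrow>
            (\<forall>t\<ge>0. w t \<in> Y1_sharp m)) \<and>
         (\<forall>m\<ge>1. positively_invariant a b (Y1_sharp m))"
  by (simp add: positively_invariant_def Y1_sharp_invariant)

end
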